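(* Let $G$ be a disjoint union of chordal graphs, including at least one singleton (that is, at least one component of $G$ is an isolated vertex), and let $r\geq 1$ be an integer. If $r\leq \frac{1}{2}\mu(G)$, then $G$ is $r$-EKR.
   Context: All graphs are finite and simple. A graph is chordal if every cycle of length at least $4$ has a chord. For a graph $G$, $\mu(G)$ denotes the minimum size of a maximal (with respect to inclusion) independent vertex set of $G$. For an integer $r\geq 1$, $\mathcal{J}^{(r)}(G)$ is the family of all independent sets of $G$ of size $r$; for $v\in V(G)$, the star centered at $v$ is $\mathcal{J}_v^{(r)}(G)=\{A\in\mathcal{J}^{(r)}(G): v\in A\}$. A family $\mathcal{A}$ of sets is intersecting if $A\cap B\neq\emptyset$ for all $A,B\in\mathcal{A}$. $G$ is $r$-EKR if no intersecting subfamily of $\mathcal{J}^{(r)}(G)$ is larger than the largest star in $\mathcal{J}^{(r)}(G)$. *)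

theory Defs
  imports Complex_Main "Graph_Theory.Pair_Digraph"
begin

text \<open>
  A finite simple graph is a \<open>pair_graph\<close>: an edge \<open>uv\<close> is
  represented by the two arcs \<open>(u, v)\<close> and \<open>(v, u)\<close>.
\<close>

text \<open>
  Cycles are lists of arcs; besides the usual cycles of a graph,
  \<^const>\<open>pre_digraph.cycle\<close> also admits going back and forth along a single edge,
  but that has length 2.
\<close>

definition chord :: "'a pair_pre_digraph \<Rightarrow> ('a \<times> 'a) list \<Rightarrow> 'a \<times> 'a \<Rightarrow> bool" where
  "chord G p e \<longleftrightarrow> e \<in> parcs G \<and> fst e \<in> fst ` set p \<and> snd e \<in> fst ` set p
     \<and> (fst e, snd e) \<notin> set p \<and> (snd e, fst e) \<notin> set p"

definition chordal :: "'a pair_pre_digraph \<Rightarrow> bool" where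
  "chordal G \<longleftrightarrow> (\<forall>p. pre_digraph.cycle (with_proj G) p \<and> 4 \<le> length p \<longrightarrow> (\<exists>e. chord G p e))"

definition is_disjoint_union :: "'a pair_pre_digraph \<Rightarrow> 'a pair_pre_digraph set \<Rightarrow> bool" where
  "is_disjoint_union G Hs \<longleftrightarrow>
     pairwise (\<lambda>H K. disjnt (pverts H) (pverts K)) Hs
     \<and> pverts G = (\<Union>H\<in>Hs. pverts H) \<and> parcs G = (\<Union>H\<in>Hs. parcs H)"

definition independent_set :: "'a pair_pre_digraph \<Rightarrow> 'a set \<Rightarrow> bool" where
  "independent_set G I \<longleftrightarrow> I \<subseteq> pverts G \<and> (\<forall>u\<in>I. \<forall>v\<in>I. (u, v) \<notin> parcs G)"

definition maximal_independent_set :: "'a pair_pre_digraph \<Rightarrow> 'a set \<Rightarrow> bool" where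
  "maximal_independent_set G I \<longleftrightarrow>
     independent_set G I \<and> (\<forall>J. independent_set G J \<and> I \<subseteq> J \<longrightarrow> J = I)"

definition mu :: "'a pair_pre_digraph \<Rightarrow> nat" where
  "mu G = Min (card ` {I. maximal_independent_set G I})"

definition indep_sets_of_size :: "nat \<Rightarrow> 'a pair_pre_digraph \<Rightarrow> 'a set set" where
  "indep_sets_of_size r G = {A. independent_set G A \<and> card A = r}"

definition indep_star :: "nat \<Rightarrow> 'a pair_pre_digraph \<Rightarrow> 'a \<Rightarrow> 'a set set" where
  "indep_star r G v = {A \<in> indep_sets_of_size r G. v \<in> A}"

definition intersecting :: "'a set set \<Rightarrow> bool" where
  "intersecting \<A> \<longleftrightarrow> (\<forall>A\<in>\<A>. \<forall>B\<in>\<A>. A \<inter> B \<noteq> {})"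

text \<open>Only meaningful for graphs with at least one vertex, since otherwise there is no star.\<close>

definition EKR :: "nat \<Rightarrow> 'a pair_pre_digraph \<Rightarrow> bool" where
  "EKR r G \<longleftrightarrow> (\<forall>\<A> \<subseteq> indep_sets_of_size r G. intersecting \<A> \<longrightarrow>
     card \<A> \<le> Max ((\<lambda>v. card (indep_star r G v)) ` pverts G))"

end

theory Submission
  imports Defs
begin

text \<open>
  The largest star is centred at an isolated vertex \<open>x\<close>: by induction on the number of
  vertices, every intersecting family \<open>\<A>\<close> of independent \<open>r\<close>-sets is at most as
  large as the star at \<open>x\<close>, provided that all maximal independent sets have at least
  \<open>2 r\<close> elements.

  The induction removes a vertex \<open>a \<noteq> x\<close>. The members of the family that avoid \<open>a\<close> live on
  \<open>V - a\<close>; those that contain \<open>a\<close> become, once \<open>a\<close> is taken out, independent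
  \<open>(r - 1)\<close>-sets on \<open>V - N[a]\<close>. The star at \<open>x\<close> splits in the same way
  (\<open>card_indep_star_deletion\<close>), so the two bounds add up to the right number. What may fail is
  that the sets of the second kind still meet after the loss of \<open>a\<close>. Call a vertex \<open>b\<close>
  dominated by \<open>a\<close> if every neighbour of \<open>b\<close> is \<open>a\<close> or a neighbour of \<open>a\<close>; then \<open>a\<close>
  can be exchanged for \<open>b\<close> in any independent set that contains \<open>a\<close> but not \<open>b\<close>. Shifting \<open>\<A>\<close> from \<open>a\<close> to the
  vertices that it dominates, for as long as this lowers the number of sets containing \<open>a\<close>, gives
  a family that is closed under these exchanges (\<open>obtain_shifted_family\<close>). If now two sets
  \<open>A, B\<close> of the family contain \<open>a\<close> and some dominated \<open>b\<close> lies outside both, then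
  \<open>A - a + b\<close> belongs to the family and meets \<open>B\<close>, necessarily in a point of \<open>A \<inter> B\<close> other
  than \<open>a\<close> (\<open>star_bound_deletion\<close>).

  Such vertices exist in two situations. If the graph has an edge, chordality gives a simplicial
  vertex \<open>b\<close> with a neighbour \<open>a\<close>; it is dominated by \<open>a\<close>, and no independent set contains both.
  Neither \<open>V - a\<close> nor \<open>V - N[a]\<close> spoils the bound on maximal independent sets: one maximal in
  \<open>V - a\<close> is maximal in \<open>V\<close>, and one maximal in \<open>V - N[a]\<close> becomes so by adding \<open>a\<close>. If
  the graph has no edges, all vertices dominate each other and the claim is the theorem of Erdos,
  Ko and Rado. Two \<open>r\<close>-sets through \<open>a\<close> cover at most \<open>2 r - 1\<close> vertices, so
  the induction runs down to \<open>card V = 2 r\<close>, where a set and its complement are never both in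
  the family.

  That chordal graphs have simplicial vertices (\<open>ex_simplicial\<close>) is shown by means of a
  largest connected set \<open>H\<close> that does not dominate the graph. All neighbours of \<open>H\<close> are then
  adjacent to each other and to all the vertices far from \<open>H\<close>, so a vertex that is simplicial among
  the latter, which exists by induction, is simplicial in the whole graph.
\<close>

section \<open>Shifting\<close>

text \<open>
  The exchange is suspended where its result is already in \<open>\<A>\<close>; this makes the map injective
  on \<open>\<A>\<close>.
\<close>

definition shift :: "'a \<Rightarrow> 'a \<Rightarrow> 'a set set \<Rightarrow> 'a set \<Rightarrow> 'a set" where
  "shift a b \<A> A =
     (if a \<in> A \<and> b \<notin> A \<and> insert b (A - {a}) \<notin> \<A> then insert b (A - {a}) else A)"

lemma inj_on_shift: "inj_on (shift a b \<A>) \<A>"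
proof (rule inj_onI)
  fix A B assume AB: "A \<in> \<A>" "B \<in> \<A>" "shift a b \<A> A = shift a b \<A> B"
  have undo: "A = insert a (insert b (A - {a}) - {b})" if "a \<in> A" "b \<notin> A" for A
    using that by auto
  show "A = B"
    using AB undo[of A] undo[of B] unfolding shift_def by (metis (lifting))
qed

text \<open>
  The critical case is that of a moved \<open>A\<close> and an unmoved \<open>B\<close> with \<open>a \<in> B\<close> and
  \<open>b \<notin> B\<close>: then \<open>B\<close> stayed because \<open>B - a + b\<close> is itself in \<open>\<A>\<close>, and \<open>A\<close> meets
  that set in a point other than \<open>a\<close> and \<open>b\<close>.
\<close>

lemma intersecting_shift:
  assumes "intersecting \<A>"
  shows "intersecting (shift a b \<A> ` \<A>)"
proof -
  have mixed: "insert b (A - {a}) \<inter> B \<noteq> {}"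
    if A: "A \<in> \<A>" "a \<in> A" "b \<notin> A" and B: "B \<in> \<A>" "shift a b \<A> B = B" for A B
  proof (cases "a \<in> B \<and> b \<notin> B")
    case True
    then have "insert b (B - {a}) \<in> \<A>"
      using B by (auto simp: shift_def split: if_splits)
    then have "A \<inter> insert b (B - {a}) \<noteq> {}"
      using assms A(1) unfolding intersecting_def by blast
    then show ?thesis using A by blast
  next
    case False
    have "A \<inter> B \<noteq> {}" using assms A(1) B(1) by (auto simp: intersecting_def)
    then show ?thesis using False by blast
  qed
  show ?thesis
    unfolding intersecting_def
  proof (intro ballI)
    fix A' B' assume "A' \<in> shift a b \<A> ` \<A>" "B' \<in> shift a b \<A> ` \<A>"
    then obtain A B where A: "A \<in> \<A>" "A' = shift a b \<A> A" and B: "B \<in> \<A>" "B' = shift a b \<A> B"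
      by blast
    have moved: "a \<in> C \<and> b \<notin> C \<and> shift a b \<A> C = insert b (C - {a})" if "shift a b \<A> C \<noteq> C" for C
      using that by (auto simp: shift_def split: if_splits)
    show "A' \<inter> B' \<noteq> {}"
    proof (cases "shift a b \<A> A = A")
      case True
      show ?thesis
      proof (cases "shift a b \<A> B = B")
        case True
        then have "A' = A" "B' = B" using \<open>shift a b \<A> A = A\<close> A(2) B(2) by metis+
        then show ?thesis using assms A(1) B(1) unfolding intersecting_def by blast
      next
        case False
        then show ?thesis
          using mixed[OF B(1) _ _ A(1) True] moved[of B] A(2) B(2) True
          by (simp add: Int_commute)
      qed
    next
      case False
      show ?thesis
      proof (cases "shift a b \<A> B = B")
        case True
        then show ?thesis
          using mixed[OF A(1) _ _ B(1) True] moved[of A] A(2) B(2) False by simp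
      next
        case False
        then have "b \<in> A'" "b \<in> B'"
          using moved[of A] moved[of B] A(2) B(2) \<open>shift a b \<A> A \<noteq> A\<close> by simp_all
        then show ?thesis by blast
      qed
    qed
  qed
qed

section \<open>Independent sets under deletion of vertices\<close>

text \<open>
  Arcs of \<open>E\<close> that leave \<open>V\<close> may be present; they do not affect independence of subsets
  of \<open>V\<close>. Subgraphs induced by vertex sets thus share one and the same \<open>E\<close>.
\<close>

abbreviation graph_on :: "'a set \<Rightarrow> 'a rel \<Rightarrow> 'a pair_pre_digraph" where
  "graph_on V E \<equiv> \<lparr>pverts = V, parcs = E\<rparr>"

lemma mem_indep_sets_of_size:
  "A \<in> indep_sets_of_size r (graph_on V E) \<longleftrightarrow>
     A \<subseteq> V \<and> (\<forall>u\<in>A. \<forall>v\<in>A. (u, v) \<notin> E) \<and> card A = r"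
  by (auto simp: indep_sets_of_size_def independent_set_def)

lemma finite_indep_sets_of_size:
  "finite V \<Longrightarrow> finite (indep_sets_of_size r (graph_on V E))"
  by (rule finite_subset[of _ "Pow V"]) (auto simp: mem_indep_sets_of_size)

lemma maximal_independent_set_graph_on:
  assumes "sym E" "irrefl E"
  shows "maximal_independent_set (graph_on V E) M \<longleftrightarrow>
     M \<subseteq> V \<and> (\<forall>u\<in>M. \<forall>v\<in>M. (u, v) \<notin> E) \<and> (\<forall>u\<in>V - M. \<exists>v\<in>M. (u, v) \<in> E)"
    (is "?L \<longleftrightarrow> ?R")
proof
  assume L: ?L
  have "\<exists>v\<in>M. (u, v) \<in> E" if u: "u \<in> V - M" for u
  proof (rule ccontr)
    assume "\<not> ?thesis"
    then have "independent_set (graph_on V E) (insert u M)"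
      using L u assms
      by (auto simp: maximal_independent_set_def independent_set_def irrefl_def dest: symD)
    then show False
      using L u unfolding maximal_independent_set_def by blast
  qed
  then show ?R using L by (auto simp: maximal_independent_set_def independent_set_def)
next
  assume R: ?R
  have "J = M" if "independent_set (graph_on V E) J" "M \<subseteq> J" for J
    using R that unfolding independent_set_def by auto blast
  then show ?L using R by (auto simp: maximal_independent_set_def independent_set_def)
qed

lemma independent_set_exchange:
  assumes E: "sym E" "irrefl E" and "finite V" and b: "b \<in> V" "E `` {b} \<inter> V \<subseteq> insert a (E `` {a})"
    and B: "B \<in> indep_sets_of_size r (graph_on V E)" "a \<in> B" "b \<notin> B"
  shows "insert b (B - {a}) \<in> indep_sets_of_size r (graph_on V E)"
proof -
  have sub: "B \<subseteq> V" and ind: "\<forall>u\<in>B. \<forall>v\<in>B. (u, v) \<notin> E" and r: "card B = r"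
    using B by (auto simp: mem_indep_sets_of_size)
  have fin: "finite B" using sub \<open>finite V\<close> by (rule finite_subset)
  have nb: "(b, y) \<notin> E" if "y \<in> B - {a}" for y
    using that b(2) sub ind B(2) by blast
  moreover have "(y, b) \<notin> E" if "y \<in> B - {a}" for y
    using nb[OF that] symD[OF E(1)] by blast
  moreover have "(b, b) \<notin> E" using E(2) by (simp add: irrefl_def)
  moreover have "card (insert b (B - {a})) = r"
    using fin r B(2,3) by (simp add: card.insert_remove card_Diff_singleton) (metis card_gt_0_iff Suc_pred empty_iff)
  ultimately show ?thesis
    using sub ind b(1) by (auto simp: mem_indep_sets_of_size)
qed

text \<open>
  A family that minimises the number of members containing \<open>a\<close>, among all intersecting families
  of the given size, is closed under the exchange of \<open>a\<close> for a dominated vertex: a shift that moves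
  some member would lower this number.
\<close>

lemma obtain_shifted_family:
  assumes E: "sym E" "irrefl E" and fin: "finite V"
    and \<A>: "\<A> \<subseteq> indep_sets_of_size r (graph_on V E)" "intersecting \<A>"
  obtains \<B> where "\<B> \<subseteq> indep_sets_of_size r (graph_on V E)" "intersecting \<B>" "card \<B> = card \<A>"
    "\<And>B b. B \<in> \<B> \<Longrightarrow> a \<in> B \<Longrightarrow> b \<in> V - B \<Longrightarrow> E `` {b} \<inter> V \<subseteq> insert a (E `` {a})
       \<Longrightarrow> insert b (B - {a}) \<in> \<B>"
proof -
  let ?J = "indep_sets_of_size r (graph_on V E)"
  let ?P = "\<lambda>\<B>. \<B> \<subseteq> ?J \<and> intersecting \<B> \<and> card \<B> = card \<A>"
  let ?m = "\<lambda>\<B>. card {B \<in> \<B>. a \<in> B}"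
  have "\<exists>\<B>. ?P \<B> \<and> (\<forall>\<C>. ?P \<C> \<longrightarrow> ?m \<B> \<le> ?m \<C>)"
    by (rule ex_has_least_nat[of ?P \<A>]) (use \<A> in simp)
  then obtain \<B> where \<B>: "?P \<B>" and least: "\<And>\<C>. ?P \<C> \<Longrightarrow> ?m \<B> \<le> ?m \<C>" by blast
  have finB: "finite \<B>" using \<B> finite_indep_sets_of_size[OF fin] finite_subset by blast
  have "insert b (B - {a}) \<in> \<B>"
    if B: "B \<in> \<B>" "a \<in> B" and b: "b \<in> V - B" "E `` {b} \<inter> V \<subseteq> insert a (E `` {a})" for B b
  proof (rule ccontr)
    assume unstable: "insert b (B - {a}) \<notin> \<B>"
    let ?C = "shift a b \<B> ` \<B>"
    have "?C \<subseteq> ?J"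
    proof
      fix C' assume "C' \<in> ?C"
      then obtain C where "C \<in> \<B>" "C' = shift a b \<B> C" by blast
      then show "C' \<in> ?J"
        using \<B> b independent_set_exchange[OF E fin, of b a C r] by (auto simp: shift_def)
    qed
    moreover have "intersecting ?C" using \<B> by (simp add: intersecting_shift)
    moreover have "card ?C = card \<A>" using \<B> by (simp add: card_image[OF inj_on_shift])
    ultimately have "?m \<B> \<le> ?m ?C" by (intro least conjI)
    also have "?m ?C < ?m \<B>"
    proof (rule psubset_card_mono)
      have "{C \<in> ?C. a \<in> C} \<subseteq> {C \<in> \<B>. a \<in> C} - {B}"
        using b B unstable by (auto simp: shift_def split: if_splits)
      then show "{C \<in> ?C. a \<in> C} \<subset> {B \<in> \<B>. a \<in> B}" using B by blast
    qed (use finB in simp)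
    finally show False by simp
  qed
  then show thesis using that \<B> by blast
qed

lemma card_indep_star_deletion:
  assumes E: "sym E" "irrefl E" and fin: "finite V" and "a \<in> V" "a \<noteq> x" "(a, x) \<notin> E"
  shows "card (indep_star (Suc s) (graph_on V E) x) =
     card (indep_star (Suc s) (graph_on (V - {a}) E) x)
     + card (indep_star s (graph_on (V - insert a (E `` {a})) E) x)"
proof -
  let ?S = "indep_star (Suc s) (graph_on V E) x"
  let ?S1 = "indep_star (Suc s) (graph_on (V - {a}) E) x"
  let ?S2 = "indep_star s (graph_on (V - insert a (E `` {a})) E) x"
  have fin1: "finite ?S1" and fin2: "finite ?S2"
    using fin by (auto simp: indep_star_def finite_indep_sets_of_size)
  have "?S = ?S1 \<union> insert a ` ?S2"
  proof (intro equalityI subsetI)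
    fix A assume A: "A \<in> ?S"
    then have Af: "finite A" using fin by (auto simp: indep_star_def mem_indep_sets_of_size intro: finite_subset)
    show "A \<in> ?S1 \<union> insert a ` ?S2"
    proof (cases "a \<in> A")
      case True
      then have "A - {a} \<in> ?S2"
        using A Af assms(5) by (auto simp: indep_star_def mem_indep_sets_of_size)
      then show ?thesis using True by (metis UnI2 imageI insert_Diff)
    qed (use A in \<open>auto simp: indep_star_def mem_indep_sets_of_size\<close>)
  next
    fix A assume "A \<in> ?S1 \<union> insert a ` ?S2"
    then consider "A \<in> ?S1" | B where "B \<in> ?S2" "A = insert a B" by blast
    then show "A \<in> ?S"
    proof cases
      case 2
      then have "finite B" "a \<notin> B"
        using fin by (auto simp: indep_star_def mem_indep_sets_of_size intro: finite_subset)
      with 2 show ?thesis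
        using E \<open>a \<in> V\<close> by (auto simp: indep_star_def mem_indep_sets_of_size irrefl_def dest: symD)
    qed (auto simp: indep_star_def mem_indep_sets_of_size)
  qed
  moreover have "?S1 \<inter> insert a ` ?S2 = {}"
    by (auto simp: indep_star_def mem_indep_sets_of_size)
  moreover have "inj_on (insert a) ?S2"
  proof (rule inj_onI)
    fix A B assume "A \<in> ?S2" "B \<in> ?S2" "insert a A = insert a B"
    moreover from this have "a \<notin> A" "a \<notin> B"
      by (auto simp: indep_star_def mem_indep_sets_of_size)
    ultimately show "A = B" by (simp add: insert_ident)
  qed
  ultimately show ?thesis
    using fin1 fin2 by (simp add: card_Un_disjoint card_image)
qed

definition star_bound :: "nat \<Rightarrow> 'a pair_pre_digraph \<Rightarrow> 'a \<Rightarrow> bool" where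
  "star_bound r G x \<longleftrightarrow>
     (\<forall>\<A> \<subseteq> indep_sets_of_size r G. intersecting \<A> \<longrightarrow> card \<A> \<le> card (indep_star r G x))"

lemma star_boundD:
  "star_bound r G x \<Longrightarrow> \<A> \<subseteq> indep_sets_of_size r G \<Longrightarrow> intersecting \<A>
     \<Longrightarrow> card \<A> \<le> card (indep_star r G x)"
  by (simp add: star_bound_def)

text \<open>
  The empty set does not meet itself, so an intersecting family of empty sets is empty. This lets
  the inductions on \<open>r\<close> start at \<open>0\<close>.
\<close>

lemma star_bound_0: "finite V \<Longrightarrow> star_bound 0 (graph_on V E) x"
proof (unfold star_bound_def, intro allI impI)
  fix \<A> assume "finite V" "\<A> \<subseteq> indep_sets_of_size 0 (graph_on V E)" "intersecting \<A>"
  then have "A = {}" if "A \<in> \<A>" for A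
    using that by (meson card_0_eq finite_subset mem_indep_sets_of_size subsetD)
  with \<open>intersecting \<A>\<close> have "\<A> = {}" by (fastforce simp: intersecting_def)
  then show "card \<A> \<le> card (indep_star 0 (graph_on V E) x)" by simp
qed

text \<open>
  The recursion behind all the bounds. After shifting, the sets through \<open>a\<close> meet outside \<open>a\<close>,
  since the vertex \<open>b\<close> provided by the hypothesis allows one of the two to give up \<open>a\<close>.
\<close>

lemma star_bound_deletion:
  assumes E: "sym E" "irrefl E" and fin: "finite V" and a: "a \<in> V" "a \<noteq> x" "(a, x) \<notin> E"
    and ex: "\<And>A B. A \<in> indep_sets_of_size (Suc s) (graph_on V E) \<Longrightarrow>
       B \<in> indep_sets_of_size (Suc s) (graph_on V E) \<Longrightarrow> a \<in> A \<Longrightarrow> a \<in> B \<Longrightarrow>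
       \<exists>b\<in>V - (A \<union> B). E `` {b} \<inter> V \<subseteq> insert a (E `` {a})"
    and del: "star_bound (Suc s) (graph_on (V - {a}) E) x"
    and link: "star_bound s (graph_on (V - insert a (E `` {a})) E) x"
  shows "star_bound (Suc s) (graph_on V E) x"
  unfolding star_bound_def
proof (intro allI impI)
  let ?J = "indep_sets_of_size (Suc s) (graph_on V E)"
  fix \<A> assume "\<A> \<subseteq> ?J" "intersecting \<A>"
  then obtain \<B> where \<B>: "\<B> \<subseteq> ?J" "intersecting \<B>" "card \<B> = card \<A>"
    and stable: "\<And>B b. B \<in> \<B> \<Longrightarrow> a \<in> B \<Longrightarrow> b \<in> V - B \<Longrightarrow> E `` {b} \<inter> V \<subseteq> insert a (E `` {a})
       \<Longrightarrow> insert b (B - {a}) \<in> \<B>"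
    using obtain_shifted_family[OF E fin, of \<A> "Suc s" a] by metis
  define \<D> where "\<D> = {B \<in> \<B>. a \<notin> B}"
  define \<L> where "\<L> = (\<lambda>B. B - {a}) ` {B \<in> \<B>. a \<in> B}"
  have finB: "finite \<B>" using \<B>(1) finite_indep_sets_of_size[OF fin] by (rule finite_subset)
  have "card \<D> \<le> card (indep_star (Suc s) (graph_on (V - {a}) E) x)"
  proof (rule star_boundD[OF del])
    show "\<D> \<subseteq> indep_sets_of_size (Suc s) (graph_on (V - {a}) E)"
      using \<B>(1) by (auto simp: \<D>_def mem_indep_sets_of_size subset_iff)
    show "intersecting \<D>" using \<B>(2) by (auto simp: \<D>_def intersecting_def)
  qed
  moreover have "card \<L> \<le> card (indep_star s (graph_on (V - insert a (E `` {a})) E) x)"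
  proof (rule star_boundD[OF link])
    show "\<L> \<subseteq> indep_sets_of_size s (graph_on (V - insert a (E `` {a})) E)"
    proof
      fix L assume "L \<in> \<L>"
      then obtain B where B: "B \<in> ?J" "a \<in> B" "L = B - {a}" using \<B>(1) by (auto simp: \<L>_def)
      moreover have "finite B" using B(1) fin by (auto simp: mem_indep_sets_of_size intro: finite_subset)
      ultimately show "L \<in> indep_sets_of_size s (graph_on (V - insert a (E `` {a})) E)"
        by (auto simp: mem_indep_sets_of_size)
    qed
    have "(A - {a}) \<inter> (B - {a}) \<noteq> {}" if AB: "A \<in> \<B>" "a \<in> A" "B \<in> \<B>" "a \<in> B" for A B
    proof -
      obtain b where b: "b \<in> V - (A \<union> B)" "E `` {b} \<inter> V \<subseteq> insert a (E `` {a})"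
        using ex[of A B] AB \<B>(1) by blast
      then have "insert b (A - {a}) \<in> \<B>" using stable[of A b] AB by blast
      then have "insert b (A - {a}) \<inter> B \<noteq> {}"
        using AB(3) \<B>(2) unfolding intersecting_def by blast
      then show ?thesis using b by blast
    qed
    then show "intersecting \<L>" by (auto simp: \<L>_def intersecting_def)
  qed
  moreover have "card \<B> = card \<D> + card \<L>"
  proof -
    have "inj_on (\<lambda>B. B - {a}) {B \<in> \<B>. a \<in> B}" by (rule inj_onI) blast
    then have "card \<L> = card {B \<in> \<B>. a \<in> B}" by (simp add: \<L>_def card_image)
    moreover have "\<B> = \<D> \<union> {B \<in> \<B>. a \<in> B}" "\<D> \<inter> {B \<in> \<B>. a \<in> B} = {}" by (auto simp: \<D>_def)
    ultimately show ?thesis using finB by (metis card_Un_disjoint finite_Un)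
  qed
  ultimately show "card \<A> \<le> card (indep_star (Suc s) (graph_on V E) x)"
    using card_indep_star_deletion[OF E fin a] \<B>(3) by simp
qed

section \<open>Graphs without edges\<close>

text \<open>
  Of two complementary \<open>r\<close>-sets at most one is in the family, and exactly one contains \<open>x\<close>.
\<close>

lemma star_bound_edgeless_half:
  assumes fin: "finite V" and "card V = 2 * r" "x \<in> V" and empty: "E \<inter> V \<times> V = {}"
  shows "star_bound r (graph_on V E) x"
  unfolding star_bound_def
proof (intro allI impI)
  fix \<A> assume \<A>: "\<A> \<subseteq> indep_sets_of_size r (graph_on V E)" "intersecting \<A>"
  let ?f = "\<lambda>A. if x \<in> A then A else V - A"
  have sub: "A \<subseteq> V" "card A = r" if "A \<in> \<A>" for A
    using subsetD[OF \<A>(1) that] by (simp_all add: mem_indep_sets_of_size)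
  have "inj_on ?f \<A>"
  proof (rule inj_onI)
    fix A B assume AB: "A \<in> \<A>" "B \<in> \<A>" "?f A = ?f B"
    then have meet: "A \<inter> B \<noteq> {}" using \<A>(2) unfolding intersecting_def by blast
    have V: "A \<subseteq> V" "B \<subseteq> V" using sub AB(1,2) by blast+
    show "A = B"
    proof (cases "x \<in> A \<longleftrightarrow> x \<in> B")
      case True
      then show ?thesis using AB(3) V by (auto split: if_splits)
    next
      case False
      then have "A = V - B \<or> V - A = B" using AB(3) by (auto split: if_splits)
      then show ?thesis using meet by blast
    qed
  qed
  moreover have "?f ` \<A> \<subseteq> indep_star r (graph_on V E) x"
  proof
    fix B assume "B \<in> ?f ` \<A>"
    then obtain A where A: "A \<in> \<A>" "B = ?f A" by blast
    have "card (V - A) = r"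
      using sub[OF A(1)] assms(2) by (simp add: card_Diff_subset finite_subset[OF _ fin])
    then have "B \<subseteq> V \<and> card B = r \<and> x \<in> B"
      unfolding A(2) using sub[OF A(1)] \<open>x \<in> V\<close> by simp
    then show "B \<in> indep_star r (graph_on V E) x"
      using empty by (auto simp: indep_star_def mem_indep_sets_of_size)
  qed
  moreover have "finite (indep_star r (graph_on V E) x)"
    using fin by (simp add: indep_star_def finite_indep_sets_of_size)
  ultimately show "card \<A> \<le> card (indep_star r (graph_on V E) x)"
    by (rule card_inj_on_le)
qed

text \<open>
  The Erdos-Ko-Rado theorem. As long as \<open>2 r < card V\<close>, two \<open>r\<close>-sets with a common
  element leave some vertex uncovered, which is dominated by every other vertex.
\<close>

lemma star_bound_edgeless:
  assumes "sym E" "irrefl E" "finite V" "x \<in> V" "2 * r \<le> card V" "E \<inter> V \<times> V = {}"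
  shows "star_bound r (graph_on V E) x"
  using assms(3-6)
proof (induction "card V" arbitrary: V r rule: less_induct)
  case less
  consider "r = 0" | "card V = 2 * r" | s where "r = Suc s" "2 * r < card V"
    using less.prems(3) by (cases r) (auto simp: le_less)
  then show ?case
  proof cases
    case 1
    then show ?thesis using star_bound_0[OF less.prems(1)] by simp
  next
    case 2
    then show ?thesis using star_bound_edgeless_half[OF less.prems(1)] less.prems(2,4) by simp
  next
    case 3
    have "\<not> V \<subseteq> {x}" using 3 card_mono[of "{x}" V] by auto
    then obtain a where a: "a \<in> V" "a \<noteq> x" by blast
    have none: "(u, v) \<notin> E" if "u \<in> V" "v \<in> V" for u v
      using that less.prems(4) by auto
    have del: "V - insert a (E `` {a}) = V - {a}" using none a by auto
    have card: "card (V - {a}) = card V - 1" using a less.prems(1) by simp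
    show ?thesis
      unfolding 3(1)
    proof (rule star_bound_deletion[OF assms(1,2) less.prems(1) a])
      show "(a, x) \<notin> E" using none a less.prems by blast
      show "star_bound (Suc s) (graph_on (V - {a}) E) x"
        by (rule less.hyps) (use 3 card less.prems a in auto)
      show "star_bound s (graph_on (V - insert a (E `` {a})) E) x"
        unfolding del by (rule less.hyps) (use 3 card less.prems a in auto)
    next
      fix A B
      assume AB: "A \<in> indep_sets_of_size (Suc s) (graph_on V E)"
        "B \<in> indep_sets_of_size (Suc s) (graph_on V E)" "a \<in> A" "a \<in> B"
      then have "card (A \<union> B) \<le> 2 * r"
        using card_Un_le[of A B] 3(1) by (simp add: mem_indep_sets_of_size)
      then have "A \<union> B \<noteq> V" using 3(2) by auto
      then obtain b where "b \<in> V - (A \<union> B)" using AB by (auto simp: mem_indep_sets_of_size)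
      moreover have "E `` {b} \<inter> V = {}" using none calculation by blast
      ultimately show "\<exists>b\<in>V - (A \<union> B). E `` {b} \<inter> V \<subseteq> insert a (E `` {a})" by blast
    qed
  qed
qed

section \<open>Simplicial vertices\<close>

text \<open>
  Holes: triangles are excluded. The indices are taken modulo \<open>n\<close>.
\<close>

definition induced_cycle :: "'a rel \<Rightarrow> nat \<Rightarrow> (nat \<Rightarrow> 'a) \<Rightarrow> bool" where
  "induced_cycle E n c \<longleftrightarrow> 4 \<le> n \<and> inj_on c {..<n}
     \<and> (\<forall>i<n. (c i, c (Suc i mod n)) \<in> E)
     \<and> (\<forall>i<n. \<forall>j<n. (c i, c j) \<in> E \<longrightarrow> j = Suc i mod n \<or> i = Suc j mod n)"

definition hole_free :: "'a set \<Rightarrow> 'a rel \<Rightarrow> bool" where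
  "hole_free V E \<longleftrightarrow> (\<forall>n c. induced_cycle E n c \<longrightarrow> \<not> c ` {..<n} \<subseteq> V)"

lemma hole_free_mono: "hole_free V E \<Longrightarrow> W \<subseteq> V \<Longrightarrow> hole_free W E"
  unfolding hole_free_def by blast

definition simplicial :: "'a set \<Rightarrow> 'a rel \<Rightarrow> 'a \<Rightarrow> bool" where
  "simplicial V E v \<longleftrightarrow>
     v \<in> V \<and> (\<forall>y\<in>V. \<forall>z\<in>V. (v, y) \<in> E \<longrightarrow> (v, z) \<in> E \<longrightarrow> y \<noteq> z \<longrightarrow> (y, z) \<in> E)"

text \<open>
  A walk of minimal length repeats no vertex and has no chord, since either would give a shortcut.
\<close>

lemma ex_shortest_path:
  assumes "(s, t) \<in> R\<^sup>*"
  obtains n f where "f 0 = s" "f n = t" "inj_on f {..n}"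
    "\<And>i. i < n \<Longrightarrow> (f i, f (Suc i)) \<in> R"
    "\<And>i j. i < j \<Longrightarrow> j \<le> n \<Longrightarrow> (f i, f j) \<in> R \<Longrightarrow> j = Suc i"
proof -
  define n where "n = (LEAST n. (s, t) \<in> R ^^ n)"
  have "\<exists>n. (s, t) \<in> R ^^ n" using assms by (simp add: rtrancl_power)
  then have "(s, t) \<in> R ^^ n" unfolding n_def by (rule LeastI_ex)
  then obtain f where f: "f 0 = s" "f n = t" "\<forall>i<n. (f i, f (Suc i)) \<in> R"
    by (auto simp: relpow_fun_conv)
  have least: "n \<le> m" if "(s, t) \<in> R ^^ m" for m
    unfolding n_def using that by (rule Least_le)
  have seg: "(f i, f (i + k)) \<in> R ^^ k" if "i + k \<le> n" for i k
    using that
  proof (induction k)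
    case (Suc k)
    then show ?case using f(3) by (auto intro!: relpow_Suc_I)
  qed simp
  have cut: "n \<le> i + k + (n - j)" if "i < j" "j \<le> n" "(f i, f j) \<in> R ^^ k" for i j k
  proof (rule least)
    have "(f 0, f i) \<in> R ^^ i" using seg[of 0 i] that by simp
    moreover have "(f j, f n) \<in> R ^^ (n - j)" using seg[of j "n - j"] that by simp
    ultimately show "(s, t) \<in> R ^^ (i + k + (n - j))"
      using that(3) f(1,2) by (auto simp: relpow_add)
  qed
  have "inj_on f {..n}"
  proof (rule linorder_inj_onI')
    fix i j assume ij: "i \<in> {..n}" "j \<in> {..n}" "i < j"
    show "f i \<noteq> f j"
    proof
      assume "f i = f j"
      then show False using cut[of i j 0] ij by simp
    qed
  qed
  moreover have "j = Suc i" if "i < j" "j \<le> n" "(f i, f j) \<in> R" for i j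
    using cut[of i j 1] that by simp
  ultimately show thesis using that[of f n] f by blast
qed

lemma induced_cycleI_path:
  assumes E: "sym E" "irrefl E" and "2 \<le> n" and inj: "inj_on f {..n}"
    and step: "\<And>i. i < n \<Longrightarrow> (f i, f (Suc i)) \<in> E"
    and chordless: "\<And>i j. i < j \<Longrightarrow> j \<le> n \<Longrightarrow> (f i, f j) \<in> E \<Longrightarrow> j = Suc i"
    and w: "w \<notin> f ` {..n}" "(f 0, w) \<in> E" "(f n, w) \<in> E"
      "\<And>i. 0 < i \<Longrightarrow> i < n \<Longrightarrow> (f i, w) \<notin> E"
  shows "induced_cycle E (n + 2) (\<lambda>i. if i \<le> n then f i else w)"
proof -
  let ?c = "\<lambda>i. if i \<le> n then f i else w"
  have "inj_on ?c {..<n + 2}"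
  proof (rule linorder_inj_onI')
    fix i j assume ij: "i \<in> {..<n + 2}" "j \<in> {..<n + 2}" "i < j"
    then have "i \<le> n" by simp
    then show "?c i \<noteq> ?c j"
      using ij inj_onD[OF inj, of i j] w(1) by auto
  qed
  moreover have "(?c i, ?c (Suc i mod (n + 2))) \<in> E" if "i < n + 2" for i
  proof -
    have "i < n \<or> i = n \<or> i = Suc n" using that by auto
    then consider "i < n" | "i = n" | "i = Suc n" by blast
    then show ?thesis
      by cases (use step w(2,3) symD[OF E(1)] in auto)
  qed
  moreover have "j = Suc i mod (n + 2) \<or> i = Suc j mod (n + 2)"
    if "i < n + 2" "j < n + 2" "(?c i, ?c j) \<in> E" for i j
  proof -
    have ord: "j = Suc i \<or> (i = 0 \<and> j = Suc n)"
      if "i < j" "j < n + 2" "(?c i, ?c j) \<in> E" for i j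
    proof (cases "j \<le> n")
      case True
      then show ?thesis using that chordless[of i j] by auto
    next
      case False
      then have "j = Suc n" "i \<le> n" using that by auto
      moreover have "(f i, w) \<in> E" using that(3) calculation by simp
      ultimately show ?thesis using w(4)[of i] by (cases "i = 0 \<or> i = n") auto
    qed
    have "i \<noteq> j" using that(3) E(2) by (auto simp: irrefl_def)
    moreover have "(?c j, ?c i) \<in> E" using symD[OF E(1) that(3)] .
    ultimately have "(j = Suc i \<or> (i = 0 \<and> j = Suc n)) \<or> (i = Suc j \<or> (j = 0 \<and> i = Suc n))"
      using ord[of i j] ord[of j i] that by (cases i j rule: linorder_cases) blast+
    then show ?thesis using that(1,2) by (elim disjE) auto
  qed
  ultimately show ?thesis using \<open>2 \<le> n\<close> unfolding induced_cycle_def by simp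
qed

text \<open>
  If \<open>s\<close> and \<open>t\<close> were not adjacent, a shortest path between them with interior in \<open>H\<close> would
  have length at least \<open>2\<close>, and \<open>w\<close>, which sees only the ends of that path, would close it
  to a hole.
\<close>

lemma common_neighbours_adjacent:
  assumes E: "sym E" "irrefl E" and hf: "hole_free V E"
    and H: "H \<subseteq> V" "\<And>u v. u \<in> H \<Longrightarrow> v \<in> H \<Longrightarrow> (u, v) \<in> (E \<inter> H \<times> H)\<^sup>*"
    and w: "w \<in> V" "w \<notin> H" "\<And>h. h \<in> H \<Longrightarrow> (h, w) \<notin> E"
    and s: "s \<in> V" "s \<notin> H" "(s, w) \<in> E" "h \<in> H" "(s, h) \<in> E"
    and t: "t \<in> V" "t \<notin> H" "(t, w) \<in> E" "k \<in> H" "(t, k) \<in> E"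
    and "s \<noteq> t"
  shows "(s, t) \<in> E"
proof (rule ccontr)
  assume nadj: "(s, t) \<notin> E"
  let ?U = "H \<union> {s, t}"
  let ?R = "E \<inter> ?U \<times> ?U"
  have "(h, k) \<in> ?R\<^sup>*"
    using H(2)[OF s(4) t(4)] rtrancl_mono[of "E \<inter> H \<times> H" ?R] by blast
  moreover have "(s, h) \<in> ?R" "(k, t) \<in> ?R" using s t symD[OF E(1)] by auto
  ultimately have "(s, t) \<in> ?R\<^sup>*" by (meson converse_rtrancl_into_rtrancl rtrancl.rtrancl_into_rtrancl)
  then obtain n f where f: "f 0 = s" "f n = t" "inj_on f {..n}"
    "\<And>i. i < n \<Longrightarrow> (f i, f (Suc i)) \<in> ?R"
    "\<And>i j. i < j \<Longrightarrow> j \<le> n \<Longrightarrow> (f i, f j) \<in> ?R \<Longrightarrow> j = Suc i"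
    using ex_shortest_path[of s t ?R] by metis
  have "n \<noteq> 0" using f(1,2) \<open>s \<noteq> t\<close> by metis
  moreover have "n \<noteq> 1" using f(1,2) f(4)[of 0] nadj by auto
  ultimately have n: "2 \<le> n" by simp
  have U: "f i \<in> ?U" if "i \<le> n" for i
    using f(4)[of i] f(2) that by (cases "i = n") auto
  have inner: "f i \<in> H" if "0 < i" "i < n" for i
    using U[of i] that inj_onD[OF f(3), of i 0] inj_onD[OF f(3), of i n] f(1,2) by auto
  have w_nin: "w \<notin> ?U" using w(2) s(3) t(3) E(2) by (auto simp: irrefl_def)
  have "induced_cycle E (n + 2) (\<lambda>i. if i \<le> n then f i else w)"
  proof (rule induced_cycleI_path[OF E n f(3)])
    show "(f i, f (Suc i)) \<in> E" if "i < n" for i using f(4)[OF that] by simp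
    show "j = Suc i" if "i < j" "j \<le> n" "(f i, f j) \<in> E" for i j
    proof -
      have "f i \<in> ?U" "f j \<in> ?U" using U that by simp_all
      then show ?thesis using f(5)[OF that(1,2)] that(3) by blast
    qed
    show "w \<notin> f ` {..n}" using U w_nin by blast
    show "(f 0, w) \<in> E" "(f n, w) \<in> E" using f(1,2) s(3) t(3) by simp_all
    show "(f i, w) \<notin> E" if "0 < i" "i < n" for i using inner[OF that] w(3) by blast
  qed
  moreover have "(\<lambda>i. if i \<le> n then f i else w) ` {..<n + 2} \<subseteq> V"
    using U H(1) s(1) t(1) w(1) by auto
  ultimately show False using hf unfolding hole_free_def by blast
qed

text \<open>
  Any vertex of a complete graph is simplicial. Otherwise take a largest connected \<open>H\<close> for which the set \<open>W\<close> of vertices that are neither in \<open>H\<close> nor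
  adjacent to it is nonempty. A neighbour \<open>u\<close> of \<open>H\<close> must be adjacent to all of \<open>W\<close>, for otherwise
  \<open>u\<close> could be added to \<open>H\<close>. Hence the neighbours of \<open>H\<close> form a clique, by
  \<open>common_neighbours_adjacent\<close>, and a simplicial vertex of \<open>W\<close> is simplicial in \<open>V\<close>.
\<close>

lemma ex_simplicial:
  assumes E: "sym E" "irrefl E" and "finite V" "V \<noteq> {}" "hole_free V E"
  shows "\<exists>v. simplicial V E v"
  using assms(3-5)
proof (induction "card V" arbitrary: V rule: less_induct)
  case less
  show ?case
  proof (cases "\<forall>u\<in>V. \<forall>v\<in>V. u \<noteq> v \<longrightarrow> (u, v) \<in> E")
    case True
    then show ?thesis using \<open>V \<noteq> {}\<close> by (auto simp: simplicial_def)
  next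
    case False
    then obtain a b where ab: "a \<in> V" "b \<in> V" "a \<noteq> b" "(a, b) \<notin> E" by blast
    define conn where "conn H \<longleftrightarrow> (\<forall>u\<in>H. \<forall>v\<in>H. (u, v) \<in> (E \<inter> H \<times> H)\<^sup>*)" for H
    define far where "far H = {w \<in> V - H. \<forall>h\<in>H. (h, w) \<notin> E}" for H
    let ?P = "\<lambda>H. H \<subseteq> V \<and> H \<noteq> {} \<and> conn H \<and> far H \<noteq> {}"
    \<comment> \<open>a single vertex with a non-neighbour is a candidate for \<open>H\<close>\<close>
    have "?P {a}" using ab by (auto simp: conn_def far_def)
    moreover have "\<forall>H. ?P H \<longrightarrow> card H < Suc (card V)"
      using card_mono[OF less.prems(1)] by (simp add: less_Suc_eq_le)
    ultimately have "\<exists>H. ?P H \<and> (\<forall>K. ?P K \<longrightarrow> card K \<le> card H)"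
      by (rule Lattices_Big.ex_has_greatest_nat)
    then obtain H where H: "?P H" and max: "\<And>K. ?P K \<Longrightarrow> card K \<le> card H"
      by (elim exE conjE) blast
    define W where "W = far H"
    have finH: "finite H" using H finite_subset[OF _ less.prems(1)] by simp
    have joined: "(u, w) \<in> E" if u: "u \<in> V - H" "h \<in> H" "(h, u) \<in> E" and w: "w \<in> W" for u h w
    proof (rule ccontr)
      assume nadj: "(u, w) \<notin> E"
      let ?K = "insert u H"
      let ?R = "E \<inter> ?K \<times> ?K"
      have HR: "(v, v') \<in> ?R\<^sup>*" if "v \<in> H" "v' \<in> H" for v v'
        using that H rtrancl_mono[of "E \<inter> H \<times> H" ?R] unfolding conn_def by blast
      have "(u, h) \<in> ?R" "(h, u) \<in> ?R" using u symD[OF E(1)] by auto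
      then have to: "(u, v) \<in> ?R\<^sup>*" "(v, u) \<in> ?R\<^sup>*" if "v \<in> H" for v
        using HR[OF u(2) that] HR[OF that u(2)]
        by (meson converse_rtrancl_into_rtrancl rtrancl.rtrancl_into_rtrancl)+
      have "conn ?K"
        unfolding conn_def using HR to by auto
      moreover have "w \<in> far ?K"
        using w nadj u unfolding W_def far_def by auto
      ultimately have "card ?K \<le> card H" using max[of ?K] u H by auto
      then show False using u(1) finH by simp
    qed
    have W: "W \<subseteq> V" "W \<noteq> {}" "W \<inter> H = {}" using H by (auto simp: W_def far_def)
    have "card W < card V" using W H less.prems(1) by (intro psubset_card_mono) auto
    then obtain v where v: "simplicial W E v"
      using less.hyps[of W] W less.prems finite_subset hole_free_mono by metis
    have "(y, z) \<in> E" if y: "y \<in> V" "(v, y) \<in> E" and z: "z \<in> V" "(v, z) \<in> E" and "y \<noteq> z" for y z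
    proof -
      have vW: "v \<in> W" using v by (simp add: simplicial_def)
      have notH: "x \<notin> H" if "(v, x) \<in> E" for x
        using vW that symD[OF E(1)] by (auto simp: W_def far_def)
      have split: "x \<in> W \<or> (\<exists>h\<in>H. (h, x) \<in> E)" if "x \<in> V" "(v, x) \<in> E" for x
        using that notH by (auto simp: W_def far_def)
      \<comment> \<open>each neighbour of \<open>v\<close> lies in \<open>W\<close> or is adjacent to \<open>H\<close>\<close>
      consider "y \<in> W" "z \<in> W" | h where "h \<in> H" "(h, y) \<in> E" "z \<in> W"
        | h where "h \<in> H" "(h, z) \<in> E" "y \<in> W"
        | h k where "h \<in> H" "(h, y) \<in> E" "k \<in> H" "(k, z) \<in> E"
        using split[OF y] split[OF z] by blast
      then show ?thesis
      proof cases
        case 1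
        then show ?thesis using v that by (auto simp: simplicial_def)
      next
        case 2
        then show ?thesis using joined[of y h z] y notH by blast
      next
        case 3
        then show ?thesis using joined[of z h y] z notH symD[OF E(1)] by blast
      next
        case 4
        show ?thesis
        proof (rule common_neighbours_adjacent[OF E less.prems(3), of H v y h z k])
          show "(v', v'') \<in> (E \<inter> H \<times> H)\<^sup>*" if "v' \<in> H" "v'' \<in> H" for v' v''
            using H that by (auto simp: conn_def)
          show "(h, v) \<notin> E" if "h \<in> H" for h using vW that by (auto simp: W_def far_def)
        qed (use H 4 y z vW W notH symD[OF E(1)] \<open>y \<noteq> z\<close> in auto)
      qed
    qed
    then show ?thesis using v W by (auto simp: simplicial_def intro!: exI[of _ v])
  qed
qed

section \<open>Chordal graphs\<close>

lemma pcas_upt: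
  "a \<le> b \<Longrightarrow> pcas (g a) (map (\<lambda>i. (g i, g (Suc i))) [a..<b]) (g b)"
  by (induction "b - a" arbitrary: a) (auto simp: upt_conv_Cons)

lemma cycle_of_induced_cycle:
  assumes "pair_wf_digraph G" and c: "induced_cycle (parcs G) n c"
  shows "pre_digraph.cycle (with_proj G) (map (\<lambda>i. (c i, c (Suc i mod n))) [0..<n])"
    (is "pre_digraph.cycle _ ?p")
proof -
  interpret pair_wf_digraph G by fact
  have n: "4 \<le> n" and inj: "inj_on c {..<n}"
    and arc: "\<And>i. i < n \<Longrightarrow> (c i, c (Suc i mod n)) \<in> parcs G"
    using c by (auto simp: induced_cycle_def)
  have p: "?p = map (\<lambda>i. (c (i mod n), c (Suc i mod n))) [0..<n]" by simp
  have "pcas (c 0) ?p (c 0)"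
    unfolding p using pcas_upt[of 0 n "\<lambda>i. c (i mod n)"] by simp
  moreover have "c 0 \<in> pverts G" using arc[of 0] n in_arcsD1 by auto
  moreover have "set ?p \<subseteq> parcs G" using arc by auto
  ultimately have walk: "awalk (c 0) ?p (c 0)" by (simp add: awalk_def)
  have "distinct (map (\<lambda>i. c (Suc i mod n)) [0..<n])"
  proof -
    have "inj_on (\<lambda>i. c (Suc i mod n)) {0..<n}"
    proof (rule inj_onI)
      fix i j assume ij: "i \<in> {0..<n}" "j \<in> {0..<n}" "c (Suc i mod n) = c (Suc j mod n)"
      then have "Suc i mod n = Suc j mod n" using n by (intro inj_onD[OF inj]) auto
      then show "i = j" using ij by (auto simp: mod_if split: if_splits)
    qed
    then show ?thesis by (simp add: distinct_map)
  qed
  moreover have "tl (awalk_verts (c 0) ?p) = map snd ?p"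
    using walk n awalk_verts_conv'[of "c 0" ?p "c 0"] by (auto simp: awalk_def)
  ultimately show ?thesis
    using walk n unfolding cycle_def by (intro exI[of _ "c 0"]) (simp add: comp_def)
qed

lemma no_induced_cycle_chordal:
  assumes "pair_wf_digraph G" "chordal G"
  shows "\<not> induced_cycle (parcs G) n c"
proof
  assume c: "induced_cycle (parcs G) n c"
  let ?p = "map (\<lambda>i. (c i, c (Suc i mod n))) [0..<n]"
  have "4 \<le> length ?p" using c by (simp add: induced_cycle_def)
  then obtain e where e: "chord G ?p e"
    using assms cycle_of_induced_cycle[OF assms(1) c] unfolding chordal_def by blast
  then obtain i j where ij: "i < n" "j < n" "fst e = c i" "snd e = c j"
    by (auto simp: chord_def)
  have "(c i, c j) \<in> parcs G" using e ij unfolding chord_def by (metis prod.collapse)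
  then have "j = Suc i mod n \<or> i = Suc j mod n"
    using c ij unfolding induced_cycle_def by blast
  then have "(c i, c j) \<in> set ?p \<or> (c j, c i) \<in> set ?p" using ij by auto
  then show False using e ij by (simp add: chord_def)
qed

lemma disjoint_union_arc:
  assumes "is_disjoint_union G Hs" "\<And>H. H \<in> Hs \<Longrightarrow> pair_wf_digraph H"
    and "H \<in> Hs" "u \<in> pverts H" "(u, v) \<in> parcs G"
  shows "(u, v) \<in> parcs H"
proof -
  obtain K where K: "K \<in> Hs" "(u, v) \<in> parcs K" using assms(1,5) by (auto simp: is_disjoint_union_def)
  then have "u \<in> pverts K" using assms(2) pair_wf_digraph.in_arcsD1 by metis
  then have "K = H"
    using assms(1,3,4) K(1) unfolding is_disjoint_union_def pairwise_def disjnt_def by blast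
  then show ?thesis using K by simp
qed

text \<open>
  No arc joins two parts, so a hole stays inside the part that contains its first vertex.
\<close>

lemma hole_free_disjoint_union:
  assumes U: "is_disjoint_union G Hs" and H: "\<And>H. H \<in> Hs \<Longrightarrow> pair_wf_digraph H \<and> chordal H"
  shows "hole_free (pverts G) (parcs G)"
  unfolding hole_free_def
proof (intro allI impI notI)
  fix n c assume c: "induced_cycle (parcs G) n c" and "c ` {..<n} \<subseteq> pverts G"
  have n: "4 \<le> n" and arc: "\<And>i. i < n \<Longrightarrow> (c i, c (Suc i mod n)) \<in> parcs G"
    using c by (auto simp: induced_cycle_def)
  then have "c 0 \<in> pverts G" using \<open>c ` {..<n} \<subseteq> pverts G\<close> by force
  then obtain K where K: "K \<in> Hs" "c 0 \<in> pverts K" using U by (auto simp: is_disjoint_union_def)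
  have wf: "\<And>H. H \<in> Hs \<Longrightarrow> pair_wf_digraph H" using H by blast
  have inK: "c i \<in> pverts K" if "i < n" for i
    using that
  proof (induction i)
    case (Suc i)
    then have "(c i, c (Suc i)) \<in> parcs G" using arc[of i] by simp
    then have "(c i, c (Suc i)) \<in> parcs K" using disjoint_union_arc[OF U wf K(1)] Suc by simp
    then show ?case using pair_wf_digraph.in_arcsD2 wf K(1) by metis
  qed (use K in simp)
  have "(c i, c j) \<in> parcs K \<longleftrightarrow> (c i, c j) \<in> parcs G" if "i < n" for i j
    using disjoint_union_arc[OF U wf K(1) inK[OF that]] K(1) U by (auto simp: is_disjoint_union_def)
  then have "induced_cycle (parcs K) n c" using c by (simp add: induced_cycle_def)
  then show False using no_induced_cycle_chordal H K(1) by metis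
qed

section \<open>Minimum size of maximal independent sets under deletion\<close>

text \<open>
  The only question is whether \<open>a\<close> could be added to \<open>M\<close>. It cannot: \<open>M\<close> contains \<open>b\<close> or a
  neighbour of \<open>b\<close>, and either is a neighbour of \<open>a\<close>.
\<close>

lemma maximal_independent_set_delete_dominating:
  assumes E: "sym E" "irrefl E" and ab: "a \<in> V" "b \<in> V" "(b, a) \<in> E"
    and dom: "E `` {b} \<inter> V \<subseteq> insert a (E `` {a})"
    and M: "maximal_independent_set (graph_on (V - {a}) E) M"
  shows "maximal_independent_set (graph_on V E) M"
proof -
  have M': "M \<subseteq> V - {a}" "\<forall>u\<in>M. \<forall>v\<in>M. (u, v) \<notin> E" "\<forall>u\<in>V - {a} - M. \<exists>v\<in>M. (u, v) \<in> E"
    using M unfolding maximal_independent_set_graph_on[OF E] by - (elim conjE, assumption)+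
  have "a \<noteq> b" using ab(3) E(2) by (auto simp: irrefl_def)
  have "\<exists>v\<in>M. (a, v) \<in> E"
  proof (cases "b \<in> M")
    case True
    then show ?thesis using symD[OF E(1) ab(3)] by blast
  next
    case False
    then obtain v where "v \<in> M" "(b, v) \<in> E" using M'(3) ab(2) \<open>a \<noteq> b\<close> by blast
    then show ?thesis using dom M'(1) by blast
  qed
  then show ?thesis using M' unfolding maximal_independent_set_graph_on[OF E] by blast
qed

lemma maximal_independent_set_insert:
  assumes E: "sym E" "irrefl E" and a: "a \<in> V"
    and M: "maximal_independent_set (graph_on (V - insert a (E `` {a})) E) M"
  shows "maximal_independent_set (graph_on V E) (insert a M)"
proof -
  have M': "M \<subseteq> V - insert a (E `` {a})" "\<forall>u\<in>M. \<forall>v\<in>M. (u, v) \<notin> E"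
    "\<forall>u\<in>V - insert a (E `` {a}) - M. \<exists>v\<in>M. (u, v) \<in> E"
    using M unfolding maximal_independent_set_graph_on[OF E] by - (elim conjE, assumption)+
  have "(a, v) \<notin> E \<and> (v, a) \<notin> E" if "v \<in> M" for v
    using that M'(1) symD[OF E(1)] by blast
  moreover have "(a, a) \<notin> E" using E(2) by (simp add: irrefl_def)
  moreover have "\<exists>v\<in>insert a M. (u, v) \<in> E" if u: "u \<in> V - insert a M" for u
  proof (cases "(a, u) \<in> E")
    case True
    then show ?thesis using symD[OF E(1)] by blast
  next
    case False
    then show ?thesis using u M'(3) by blast
  qed
  ultimately show ?thesis
    using M'(1,2) a unfolding maximal_independent_set_graph_on[OF E] by auto
qed

section \<open>The Erdos-Ko-Rado bound\<close>

text \<open>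
  A simplicial vertex is taken among the non-isolated vertices, so that it has a neighbour \<open>a\<close> to
  be removed; \<open>a\<close> differs from \<open>x\<close> because \<open>x\<close> is isolated. On \<open>V - N[a]\<close> the maximal
  independent sets may be smaller by one than on \<open>V\<close>, which is affordable as the bound needed there
  drops by two.
\<close>

lemma star_bound_hole_free:
  assumes E: "sym E" "irrefl E" and "finite V" "hole_free V E" "x \<in> V" "E `` {x} \<inter> V = {}"
    and "\<And>M. maximal_independent_set (graph_on V E) M \<Longrightarrow> 2 * r \<le> card M"
  shows "star_bound r (graph_on V E) x"
  using assms(3-7)
proof (induction "card V" arbitrary: V r rule: less_induct)
  case less
  note fin = less.prems(1)
  show ?case
  proof (cases r)
    case 0
    then show ?thesis using star_bound_0[OF fin] by simp
  next
    case (Suc s)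
    show ?thesis
    proof (cases "E \<inter> V \<times> V = {}")
      case True
      then have "maximal_independent_set (graph_on V E) V"
        unfolding maximal_independent_set_graph_on[OF E] by blast
      then have "2 * r \<le> card V" by (rule less.prems(5))
      then show ?thesis by (rule star_bound_edgeless[OF E fin less.prems(3) _ True])
    next
      case False
      define W where "W = {u \<in> V. E `` {u} \<inter> V \<noteq> {}}"
      have "W \<noteq> {}" using False by (auto simp: W_def)
      moreover have "finite W" "hole_free W E"
        using fin hole_free_mono[OF less.prems(2)] by (auto simp: W_def)
      ultimately obtain b where b: "simplicial W E b" using ex_simplicial[OF E] by blast
      then obtain a where a: "a \<in> V" "(b, a) \<in> E" by (auto simp: simplicial_def W_def)
      have bV: "b \<in> V" using b by (simp add: simplicial_def W_def)
      have inW: "y \<in> W" if "y \<in> V" "(b, y) \<in> E" for y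
        using that bV symD[OF E(1) that(2)] by (auto simp: W_def)
      have dom: "E `` {b} \<inter> V \<subseteq> insert a (E `` {a})"
        using b inW a unfolding simplicial_def by blast
      have "a \<noteq> x" using a bV symD[OF E(1) a(2)] less.prems(4) by blast
      have "(a, x) \<notin> E" using a(1) symD[OF E(1)] less.prems(4) by blast
      show ?thesis
        unfolding Suc
      proof (rule star_bound_deletion[OF E fin a(1) \<open>a \<noteq> x\<close> \<open>(a, x) \<notin> E\<close>])
        fix A B
        assume "A \<in> indep_sets_of_size (Suc s) (graph_on V E)"
          "B \<in> indep_sets_of_size (Suc s) (graph_on V E)" "a \<in> A" "a \<in> B"
        then have "b \<notin> A \<union> B" using a(2) by (auto simp: mem_indep_sets_of_size)
        then show "\<exists>b\<in>V - (A \<union> B). E `` {b} \<inter> V \<subseteq> insert a (E `` {a})"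
          using bV dom by blast
      next
        show "star_bound (Suc s) (graph_on (V - {a}) E) x"
        proof (rule less.hyps)
          show "card (V - {a}) < card V" using a(1) fin by (rule card_Diff1_less[rotated])
          show "hole_free (V - {a}) E" using hole_free_mono[OF less.prems(2)] by blast
          show "2 * Suc s \<le> card M" if "maximal_independent_set (graph_on (V - {a}) E) M" for M
            using less.prems(5)[OF maximal_independent_set_delete_dominating[OF E a(1) bV a(2) dom that]]
              Suc by simp
        qed (use fin less.prems(3,4) \<open>a \<noteq> x\<close> in auto)
        let ?V = "V - insert a (E `` {a})"
        show "star_bound s (graph_on ?V E) x"
        proof (rule less.hyps)
          show "card ?V < card V" using a(1) fin by (intro psubset_card_mono) auto
          show "hole_free ?V E" using hole_free_mono[OF less.prems(2)] by blast
          show "2 * s \<le> card M" if M: "maximal_independent_set (graph_on ?V E) M" for M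
          proof -
            have "M \<subseteq> ?V" using M unfolding maximal_independent_set_graph_on[OF E] by (rule conjunct1)
            then have "card (insert a M) = Suc (card M)"
              using finite_subset[of M V] fin by (subst card_insert_disjoint) auto
            then show ?thesis
              using less.prems(5)[OF maximal_independent_set_insert[OF E a(1) M]] Suc by simp
          qed
        qed (use fin less.prems(3,4) \<open>a \<noteq> x\<close> \<open>(a, x) \<notin> E\<close> in auto)
      qed
    qed
  qed
qed

theorem theorem1p22:
  fixes G :: "'a pair_pre_digraph" and Hs :: "'a pair_pre_digraph set" and r :: nat
  assumes "pair_graph G"
    and "is_disjoint_union G Hs"
    and "\<And>H. H \<in> Hs \<Longrightarrow> pair_graph H \<and> chordal H"
    and "\<exists>H\<in>Hs. \<exists>v. pverts H = {v}"
    and "r \<ge> 1"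
    and "real r \<le> 1 / 2 * real (mu G)"
  shows "EKR r G"
proof -
  interpret pair_graph G by fact
  have wf: "pair_wf_digraph H" if "H \<in> Hs" for H
    using assms(3)[OF that] by (simp add: pair_graph_def pair_digraph_def pair_fin_digraph_def)
  have E: "sym (parcs G)" "irrefl (parcs G)"
    using arcs_symmetric pair_no_loops by (blast intro: symI, fastforce simp: irrefl_def)
  have fin: "finite (pverts G)" by (rule pair_finite_verts)
  have G: "graph_on (pverts G) (parcs G) = G" by simp
  obtain H x where H: "H \<in> Hs" "pverts H = {x}" using assms(4) by blast
  then have xV: "x \<in> pverts G" using assms(2) by (auto simp: is_disjoint_union_def)
  have isolated: "(x, y) \<notin> parcs G" for y
  proof
    assume "(x, y) \<in> parcs G"
    then have "(x, y) \<in> parcs H" using disjoint_union_arc[OF assms(2) wf H(1)] H(2) by simp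
    then have "y = x" using pair_wf_digraph.in_arcsD2[OF wf[OF H(1)]] H(2) by blast
    then show False using \<open>(x, y) \<in> parcs G\<close> E(2) by (simp add: irrefl_def)
  qed
  have "star_bound r (graph_on (pverts G) (parcs G)) x"
  proof (rule star_bound_hole_free[OF E fin _ xV])
    show "hole_free (pverts G) (parcs G)"
      using hole_free_disjoint_union[OF assms(2)] wf assms(3) by blast
    show "parcs G `` {x} \<inter> pverts G = {}" using isolated by blast
    fix M assume "maximal_independent_set (graph_on (pverts G) (parcs G)) M"
    then have M: "maximal_independent_set G M" unfolding G .
    have "{I. maximal_independent_set G I} \<subseteq> Pow (pverts G)"
      by (auto simp: maximal_independent_set_def independent_set_def)
    then have "finite {I. maximal_independent_set G I}"
      using fin by (meson finite_Pow_iff finite_subset)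
    then have "mu G \<le> card M" unfolding mu_def using M by (intro Min_le) auto
    then show "2 * r \<le> card M" using assms(6) by linarith
  qed
  then have bound: "star_bound r G x" unfolding G .
  show ?thesis
    unfolding EKR_def
  proof (intro allI impI)
    fix \<A> assume "\<A> \<subseteq> indep_sets_of_size r G" "intersecting \<A>"
    then have "card \<A> \<le> card (indep_star r G x)" by (rule star_boundD[OF bound])
    also have "\<dots> \<le> Max ((\<lambda>v. card (indep_star r G v)) ` pverts G)"
      using fin xV by (intro Max_ge) auto
    finally show "card \<A> \<le> Max ((\<lambda>v. card (indep_star r G v)) ` pverts G)" .
  qed
qed

end
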